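(* Let $(\mathcal L,\mathcal P)$ be an extremal configuration with $|I(\mathcal L,\mathcal P)|=N^{4/3-\epsilon}$, $\epsilon$ fixed. Let $C_1,\dots,C_{r^2}$ be a point weighted cell decomposition for $(\mathcal L,\mathcal P)$ with $N^{1/3-5\epsilon}\le r\le \frac{|I(\mathcal L,\mathcal P)|}{100|\mathcal L|}$. Then there is a set of incidences $J(\mathcal L,\mathcal P)\subset I(\mathcal L,\mathcal P)$ with $|J(\mathcal L,\mathcal P)|\gtrsim N^{4/3-\epsilon}$ such that for every line $L$ and cell $C$ for which there is $P\in C$ with $(L,P)\in J(\mathcal L,\mathcal P)$, we have $2\le |I(\{L\},C)|\lesssim N^{+}$, where $I(\{L\},C)$ is the set of incidences between $L$ and points of $C$.
   Context: Conventions: $N$ is a large parameter and $\epsilon_0>0$ a fixed small exponent (here $\epsilon\lesssim\epsilon_0$). $A\lesssim B$ means $A\le CB$ with $C$ independent of $N$. $N^{a+}$ (resp. $N^{a-}$) denotes $N^{a+\epsilon'}$ (resp. $N^{a-\epsilon'}$) for some $0\le\epsilon'\lesssim\epsilon_0$, possibly different at each occurrence. A configuration $(\mathcal L,\mathcal P)$ is a set $\mathcal L$ of lines and a set $\mathcal P$ of points in $\mathbb R^2$ with $N^{1-}\lesssim|\mathcal L|,|\mathcal P|\le N$; $I(\mathcal L,\mathcal P)$ is the set of pairs $(L,P)\in\mathcal L\times\mathcal P$ with $P\in L$; it is extremal if $|I(\mathcal L,\mathcal P)|\gtrsim N^{4/3-}$. A partition of $\mathcal P$ into $r^2$ disjoint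 subsets (cells) is a point weighted cell decomposition if no line of $\mathcal L$ is incident to points in $\gtrsim r$ cells and no cell contains $\gtrsim N^{1+}/r^2$ points of $\mathcal P$.
   Formalization: The condition that no line is incident to points in ≳ r cells is taken with an implied constant K < 100 (each line meets at most K r cells); with K ≥ 100 the claim fails, since each line may meet every cell at most once when r = |I|/(100|L|). *)

theory Defs
  imports "HOL-Analysis.Analysis"
begin

text \<open>
  Asymptotic notation is written out with explicit constants. In the definitions below,
  \<open>A\<close> is the implied multiplicative constant of \<open>\<lesssim>\<close>, and \<open>B\<close> is the implied
  constant in the exponents: \<open>N\<^sup>a\<^sup>+\<close> and \<open>N\<^sup>a\<^sup>-\<close> mean \<open>N powr (a + e)\<close> and \<open>N powr (a - e)\<close>
  for some \<open>e\<close> with \<open>0 \<le> e \<le> B * \<epsilon>\<^sub>0\<close>, chosen afresh at each occurrence. One \<open>A\<close> and one \<open>B\<close>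
  serve for several occurrences, since each condition only becomes weaker when they grow.
\<close>

definition is_line :: "(real^2) set \<Rightarrow> bool" where
  "is_line l \<longleftrightarrow> affine l \<and> aff_dim l = 1"

definition incidences ::
    "(real^2) set set \<Rightarrow> (real^2) set \<Rightarrow> ((real^2) set \<times> (real^2)) set" where
  "incidences \<L> \<P> = {(l, p). l \<in> \<L> \<and> p \<in> \<P> \<and> p \<in> l}"

definition configuration ::
    "real \<Rightarrow> real \<Rightarrow> real \<Rightarrow> real \<Rightarrow> (real^2) set set \<Rightarrow> (real^2) set \<Rightarrow> bool" where
  "configuration A B \<epsilon>\<^sub>0 N \<L> \<P> \<longleftrightarrow>
     finite \<L> \<and> finite \<P> \<and> (\<forall>l\<in>\<L>. is_line l) \<and>
     (\<exists>e\<in>{0..B * \<epsilon>\<^sub>0}. N powr (1 - e) \<le> A * real (card \<L>)) \<and> real (card \<L>) \<le> N \<and>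
     (\<exists>e\<in>{0..B * \<epsilon>\<^sub>0}. N powr (1 - e) \<le> A * real (card \<P>)) \<and> real (card \<P>) \<le> N"

definition extremal ::
    "real \<Rightarrow> real \<Rightarrow> real \<Rightarrow> real \<Rightarrow> (real^2) set set \<Rightarrow> (real^2) set \<Rightarrow> bool" where
  "extremal A B \<epsilon>\<^sub>0 N \<L> \<P> \<longleftrightarrow>
     (\<exists>e\<in>{0..B * \<epsilon>\<^sub>0}. N powr (4/3 - e) \<le> A * real (card (incidences \<L> \<P>)))"

text \<open>
  The cells are the sets \<open>C 1, \<dots>, C n\<close> with \<open>n = r\<^sup>2\<close>; they may be empty, and \<open>r\<close> itself
  need not be an integer. The implied constant \<open>K\<close> in ``no line is incident to points in
  \<open>\<greatersim> r\<close> cells'' is kept apart from \<open>A\<close>, because it has to be compared with the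
  numerical constant in the upper bound on \<open>r\<close> in the theorem.
\<close>

definition point_weighted_cell_decomposition ::
    "real \<Rightarrow> real \<Rightarrow> real \<Rightarrow> real \<Rightarrow> real \<Rightarrow> (real^2) set set \<Rightarrow> (real^2) set
      \<Rightarrow> real \<Rightarrow> nat \<Rightarrow> (nat \<Rightarrow> (real^2) set) \<Rightarrow> bool" where
  "point_weighted_cell_decomposition K A B \<epsilon>\<^sub>0 N \<L> \<P> r n C \<longleftrightarrow>
     r > 0 \<and> real n = r\<^sup>2 \<and>
     disjoint_family_on C {1..n} \<and> (\<Union>i\<in>{1..n}. C i) = \<P> \<and>
     (\<forall>l\<in>\<L>. real (card {i\<in>{1..n}. \<exists>p\<in>C i. p \<in> l}) \<le> K * r) \<and>
     (\<exists>e\<in>{0..B * \<epsilon>\<^sub>0}. \<forall>i\<in>{1..n}. real (card (C i)) \<le> A * (N powr (1 + e) / r\<^sup>2))"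

end

(*
  Since K < 100, the pairs (l, i) in which l meets the cell C i in a single point carry at most
  K r |L| <= (K / 100) |I| incidences. Two points determine a line, so the lines
  meeting a cell of m points in k > T points each carry at most 2 m^2 / T incidences there in
  total; summed over the r^2 cells, with m <= A N^(1+) / r^2 and r >= N^(1/3 - 5 eps), this is
  O(N^(4/3+) / T), which is negligible for T = N^+. J consists of the other incidences. The
  Szemeredi-Trotter theorem is not needed.
*)

theory Submission
  imports Defs
begin

text \<open>The hull is contained in \<open>l\<close>, and an affine set inside another of the same
  dimension fills it.\<close>

lemma is_line_eq_affine_hull:
  assumes "is_line l" "p \<in> l" "q \<in> l" "p \<noteq> q"
  shows "l = affine hull {p, q}"
proof -
  have "affine hull {p, q} \<subseteq> l"
    using assms by (intro hull_minimal) (auto simp: is_line_def)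
  moreover have "aff_dim (affine hull {p, q}) = aff_dim l"
    using assms by (simp add: is_line_def aff_dim_2)
  ultimately show ?thesis
    using assms affine_dim_equal[of "affine hull {p, q}" l]
    by (auto simp: is_line_def)
qed

text \<open>Double counting: the summand counts the ordered pairs of distinct points of
  \<open>X\<close> on \<open>l\<close>. Such a pair lies on only one line, so the sets of pairs are
  disjoint for different lines, and all of them sit inside \<open>X \<times> X\<close>.\<close>

lemma sum_card_pairs_on_lines_le:
  assumes "finite \<L>" "\<And>l. l \<in> \<L> \<Longrightarrow> is_line l" "finite X"
  shows "(\<Sum>l\<in>\<L>. card (X \<inter> l) * (card (X \<inter> l) - 1)) \<le> (card X)\<^sup>2"
proof -
  define D where "D l = (SIGMA p:X \<inter> l. X \<inter> l - {p})" for l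
  have fin: "finite (D l)" for l
    using assms(3) by (simp add: D_def)
  have card_D: "card (D l) = card (X \<inter> l) * (card (X \<inter> l) - 1)" for l
    using assms(3) by (simp add: D_def)
  have "D l \<inter> D l' = {}" if "l \<in> \<L>" "l' \<in> \<L>" "l \<noteq> l'" for l l'
  proof (rule ccontr)
    assume "D l \<inter> D l' \<noteq> {}"
    then obtain p q where "p \<in> l" "q \<in> l" "p \<in> l'" "q \<in> l'" "p \<noteq> q"
      by (auto simp: D_def)
    with that assms(2) show False
      by (metis is_line_eq_affine_hull)
  qed
  then have "(\<Sum>l\<in>\<L>. card (D l)) = card (\<Union>l\<in>\<L>. D l)"
    using assms(1) fin by (subst card_UN_disjoint) auto
  also have "\<dots> \<le> card (X \<times> X)"
    using assms(3) by (intro card_mono) (auto simp: D_def)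
  finally show ?thesis
    by (simp add: card_D power2_eq_square card_cartesian_product)
qed

text \<open>If \<open>k \<ge> 2\<close> then \<open>k \<le> 2 * (k - 1)\<close>, so
  \<open>T < k\<close> gives \<open>k \<le> 2 / T * (k * (k - 1))\<close>. This turns the count of
  incidences into the count of pairs on lines.\<close>

lemma card_incidences_on_rich_lines_le:
  assumes "finite \<L>" "\<And>l. l \<in> \<L> \<Longrightarrow> is_line l" "finite X" "T > 0"
  shows "(\<Sum>l\<in>\<L>. if 2 \<le> card (X \<inter> l) \<and> T < real (card (X \<inter> l)) then real (card (X \<inter> l)) else 0)
    \<le> 2 * (real (card X))\<^sup>2 / T"
proof -
  let ?k = "\<lambda>l. card (X \<inter> l)"
  have "(\<Sum>l\<in>\<L>. if 2 \<le> ?k l \<and> T < real (?k l) then real (?k l) else 0)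
    \<le> (\<Sum>l\<in>\<L>. 2 / T * real (?k l * (?k l - 1)))"
  proof (rule sum_mono)
    fix l
    show "(if 2 \<le> ?k l \<and> T < real (?k l) then real (?k l) else 0) \<le> 2 / T * real (?k l * (?k l - 1))"
    proof (cases "2 \<le> ?k l \<and> T < real (?k l)")
      case True
      then have "T \<le> 2 * real (?k l - 1)"
        by linarith
      then have "real (?k l) * T \<le> real (?k l) * (2 * real (?k l - 1))"
        by (rule mult_left_mono) simp
      then show ?thesis
        using True assms(4) by (simp add: field_simps)
    qed (use assms(4) in auto)
  qed
  also have "\<dots> = 2 / T * real (\<Sum>l\<in>\<L>. ?k l * (?k l - 1))"
    by (simp add: sum_distrib_left)
  also have "\<dots> \<le> 2 / T * real ((card X)\<^sup>2)"
    using assms(4) by (intro mult_left_mono of_nat_mono sum_card_pairs_on_lines_le assms(1-3)) auto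
  finally show ?thesis
    by simp
qed

lemma card_incidences_singleton: "card (incidences {l} X) = card (X \<inter> l)"
proof -
  have "incidences {l} X = Pair l ` (X \<inter> l)"
    by (auto simp: incidences_def)
  then show ?thesis
    by (simp add: card_image inj_on_def)
qed

text \<open>The predicate \<open>Q\<close> tests in how many points the line meets the cell
  containing the incidence. Keeping it abstract lets the singly met, moderately met and richly met
  classes share one union bound.\<close>

definition incidences_with_count ::
    "(nat \<Rightarrow> bool) \<Rightarrow> (real^2) set set \<Rightarrow> nat \<Rightarrow> (nat \<Rightarrow> (real^2) set)
      \<Rightarrow> ((real^2) set \<times> (real^2)) set" where
  "incidences_with_count Q \<L> n C =
     {(l, p). l \<in> \<L> \<and> (\<exists>i\<in>{1..n}. p \<in> C i \<and> p \<in> l \<and> Q (card (C i \<inter> l)))}"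

text \<open>The set is the union, over the pairs \<open>(l, i)\<close> that satisfy
  \<open>Q\<close>, of copies of \<open>C i \<inter> l\<close>; the union bound does the
  rest.\<close>

lemma
  assumes "finite \<L>" "\<And>i. i \<in> {1..n} \<Longrightarrow> finite (C i)"
  shows finite_incidences_with_count: "finite (incidences_with_count Q \<L> n C)"
    and card_incidences_with_count_le: "card (incidences_with_count Q \<L> n C) \<le>
      (\<Sum>l\<in>\<L>. \<Sum>i\<in>{1..n}. if Q (card (C i \<inter> l)) then card (C i \<inter> l) else 0)"
proof -
  define D where "D l i = (if Q (card (C i \<inter> l)) then Pair l ` (C i \<inter> l) else {})" for l i
  have eq: "incidences_with_count Q \<L> n C = (\<Union>l\<in>\<L>. \<Union>i\<in>{1..n}. D l i)"
    by (fastforce simp: incidences_with_count_def D_def split: if_splits)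
  have card_D: "card (D l i) = (if Q (card (C i \<inter> l)) then card (C i \<inter> l) else 0)" for l i
    by (simp add: D_def card_image inj_on_def)
  show "finite (incidences_with_count Q \<L> n C)"
    unfolding eq using assms by (auto simp: D_def)
  have "card (\<Union>l\<in>\<L>. \<Union>i\<in>{1..n}. D l i) \<le> (\<Sum>l\<in>\<L>. card (\<Union>i\<in>{1..n}. D l i))"
    by (rule card_UN_le[OF assms(1)])
  also have "\<dots> \<le> (\<Sum>l\<in>\<L>. \<Sum>i\<in>{1..n}. card (D l i))"
    by (intro sum_mono card_UN_le) simp
  finally show "card (incidences_with_count Q \<L> n C) \<le>
      (\<Sum>l\<in>\<L>. \<Sum>i\<in>{1..n}. if Q (card (C i \<inter> l)) then card (C i \<inter> l) else 0)"
    by (simp only: eq card_D)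
qed

text \<open>A cell met in exactly one point contributes a single incidence, so on each line these
  incidences are no more numerous than the cells met.\<close>

lemma card_singly_met_incidences_le:
  assumes "finite \<L>" "\<And>i. i \<in> {1..n} \<Longrightarrow> finite (C i)"
    and met: "\<And>l. l \<in> \<L> \<Longrightarrow> real (card {i\<in>{1..n}. \<exists>p\<in>C i. p \<in> l}) \<le> s"
  shows "real (card (incidences_with_count (\<lambda>k. k = 1) \<L> n C)) \<le> s * real (card \<L>)"
proof -
  have "(\<Sum>i\<in>{1..n}. if card (C i \<inter> l) = 1 then card (C i \<inter> l) else 0)
      \<le> card {i\<in>{1..n}. \<exists>p\<in>C i. p \<in> l}" for l
  proof -
    have "(\<Sum>i\<in>{1..n}. if card (C i \<inter> l) = 1 then card (C i \<inter> l) else 0)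
        \<le> (\<Sum>i\<in>{1..n}. if \<exists>p\<in>C i. p \<in> l then 1 else 0)"
      by (intro sum_mono) (auto simp: card_1_singleton_iff)
    then show ?thesis
      by (simp add: sum.If_cases Int_def)
  qed
  then have "card (incidences_with_count (\<lambda>k. k = 1) \<L> n C)
      \<le> (\<Sum>l\<in>\<L>. card {i\<in>{1..n}. \<exists>p\<in>C i. p \<in> l})"
    by (intro order_trans[OF card_incidences_with_count_le] sum_mono assms)
  then have "real (card (incidences_with_count (\<lambda>k. k = 1) \<L> n C))
      \<le> (\<Sum>l\<in>\<L>. real (card {i\<in>{1..n}. \<exists>p\<in>C i. p \<in> l}))"
    by (simp flip: of_nat_sum)
  also have "\<dots> \<le> s * real (card \<L>)"
    using sum_mono[OF met, of \<L> "\<lambda>l. l"] by (simp add: mult.commute)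
  finally show ?thesis .
qed

text \<open>After exchanging the sums, the bound for rich lines applies to each cell
  separately.\<close>

lemma card_richly_met_incidences_le:
  assumes "finite \<L>" "\<And>l. l \<in> \<L> \<Longrightarrow> is_line l" "\<And>i. i \<in> {1..n} \<Longrightarrow> finite (C i)" "T > 0"
    and size: "\<And>i. i \<in> {1..n} \<Longrightarrow> real (card (C i)) \<le> m"
  shows "real (card (incidences_with_count (\<lambda>k. 2 \<le> k \<and> T < real k) \<L> n C))
    \<le> real n * (2 * m\<^sup>2 / T)"
proof -
  let ?f = "\<lambda>l i. if 2 \<le> card (C i \<inter> l) \<and> T < real (card (C i \<inter> l)) then card (C i \<inter> l) else 0"
  have "real (card (incidences_with_count (\<lambda>k. 2 \<le> k \<and> T < real k) \<L> n C))
      \<le> real (\<Sum>l\<in>\<L>. \<Sum>i\<in>{1..n}. ?f l i)"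
    using card_incidences_with_count_le[OF assms(1,3)] by (intro of_nat_mono)
  also have "\<dots> = real (\<Sum>i\<in>{1..n}. \<Sum>l\<in>\<L>. ?f l i)"
    by (subst sum.swap) (rule refl)
  also have "\<dots> = (\<Sum>i\<in>{1..n}. \<Sum>l\<in>\<L>. real (?f l i))"
    by simp
  also have "\<dots> \<le> (\<Sum>i\<in>{1..n}. 2 * m\<^sup>2 / T)"
  proof (rule sum_mono)
    fix i assume i: "i \<in> {1..n}"
    have "(\<Sum>l\<in>\<L>. real (?f l i)) \<le> 2 * (real (card (C i)))\<^sup>2 / T"
      using card_incidences_on_rich_lines_le[OF assms(1,2) assms(3)[OF i] assms(4)]
      by (simp add: if_distrib cong: if_cong)
    also have "\<dots> \<le> 2 * m\<^sup>2 / T"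
      using size[OF i] assms(4) by (intro divide_right_mono mult_left_mono power_mono) auto
    finally show "(\<Sum>l\<in>\<L>. real (?f l i)) \<le> 2 * m\<^sup>2 / T" .
  qed
  finally show ?thesis
    by simp
qed

text \<open>The three constants are chosen before \<open>\<epsilon>\<^sub>0\<close>,
  \<open>\<epsilon>\<close> and \<open>N\<close>, so they depend on \<open>K\<close>,
  \<open>A\<close> and \<open>B\<close> only; \<open>\<epsilon> \<le> B * \<epsilon>\<^sub>0\<close>
  renders the convention that \<open>\<epsilon>\<close> is at most a constant times
  \<open>\<epsilon>\<^sub>0\<close>.\<close>

theorem theorem2p7:
  fixes K A B :: real
  assumes "K < 100"
  shows "\<exists>c C' B'. c > 0 \<and> C' > 0 \<and> B' > 0 \<and>
    (\<forall>\<epsilon>\<^sub>0>0. \<forall>\<epsilon>\<le>B * \<epsilon>\<^sub>0. \<forall>\<^sub>F N :: real in at_top.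
      \<forall>(\<L> :: (real^2) set set) (\<P> :: (real^2) set) (r :: real) (n :: nat) (C :: nat \<Rightarrow> (real^2) set).
        configuration A B \<epsilon>\<^sub>0 N \<L> \<P> \<longrightarrow>
        extremal A B \<epsilon>\<^sub>0 N \<L> \<P> \<longrightarrow>
        real (card (incidences \<L> \<P>)) = N powr (4/3 - \<epsilon>) \<longrightarrow>
        point_weighted_cell_decomposition K A B \<epsilon>\<^sub>0 N \<L> \<P> r n C \<longrightarrow>
        N powr (1/3 - 5 * \<epsilon>) \<le> r \<longrightarrow>
        r \<le> real (card (incidences \<L> \<P>)) / (100 * real (card \<L>)) \<longrightarrow>
        (\<exists>J \<subseteq> incidences \<L> \<P>.
           c * N powr (4/3 - \<epsilon>) \<le> real (card J) \<and>
           (\<exists>e\<in>{0..B' * \<epsilon>\<^sub>0}. \<forall>l\<in>\<L>. \<forall>i\<in>{1..n}. (\<exists>p\<in>C i. (l, p) \<in> J) \<longrightarrow>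
              2 \<le> card (incidences {l} (C i)) \<and>
              real (card (incidences {l} (C i))) \<le> C' * N powr e)))"
proof -
  \<comment> \<open>Half of the fraction of incidences left once the singly met ones are removed:
    one half pays for the richly met ones, the other remains for \<open>J\<close>. Truncating
    \<open>K\<close> at 0 makes it a factor by which inequalities may be multiplied.\<close>
  define \<delta> where "\<delta> = (1 - max K 0 / 100) / 2"
  \<comment> \<open>Chosen so that \<open>\<delta> * C'\<close> exceeds the factor
    \<open>2 * A\<^sup>2\<close> in the bound for richly met incidences; the \<open>+ 1\<close>
    keeps \<open>C'\<close> positive when \<open>A = 0\<close>.\<close>
  define C' where "C' = 2 * (A\<^sup>2 + 1) / \<delta>"
  \<comment> \<open>The 13 is 2 from the squared cell size, 1 from the exponent of the number of
    incidences and 10 from the square of the lower bound on \<open>r\<close>. The maximum with 1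
    keeps \<open>B'\<close> positive.\<close>
  define B' where "B' = max 1 (13 * B)"
  have \<delta>: "\<delta> > 0"
    using assms by (simp add: \<delta>_def)
  have C': "C' > 0"
    unfolding C'_def using \<delta> by (intro divide_pos_pos mult_pos_pos add_nonneg_pos) auto
  have B': "B' > 0"
    by (simp add: B'_def)
  \<comment> \<open>No threshold beyond \<open>N \<ge> 1\<close> is required: this makes
    \<open>powr\<close> monotone in the exponent.\<close>
  have main: "\<exists>J \<subseteq> incidences \<L> \<P>.
           \<delta> * N powr (4/3 - \<epsilon>) \<le> real (card J) \<and>
           (\<exists>e\<in>{0..B' * \<epsilon>\<^sub>0}. \<forall>l\<in>\<L>. \<forall>i\<in>{1..n}. (\<exists>p\<in>C i. (l, p) \<in> J) \<longrightarrow>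
              2 \<le> card (incidences {l} (C i)) \<and>
              real (card (incidences {l} (C i))) \<le> C' * N powr e)"
    if \<epsilon>\<^sub>0: "\<epsilon>\<^sub>0 > 0" and \<epsilon>: "\<epsilon> \<le> B * \<epsilon>\<^sub>0" and N: "N \<ge> 1"
      and conf: "configuration A B \<epsilon>\<^sub>0 N \<L> \<P>"
      and card_I: "real (card (incidences \<L> \<P>)) = N powr (4/3 - \<epsilon>)"
      and dec: "point_weighted_cell_decomposition K A B \<epsilon>\<^sub>0 N \<L> \<P> r n C"
      and r_ge: "N powr (1/3 - 5 * \<epsilon>) \<le> r"
      and r_le: "r \<le> real (card (incidences \<L> \<P>)) / (100 * real (card \<L>))"
    for \<epsilon>\<^sub>0 \<epsilon> N r :: real and \<L> :: "(real^2) set set" and \<P> :: "(real^2) set"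
      and n :: nat and C :: "nat \<Rightarrow> (real^2) set"
  proof -
    define T where "T = C' * N powr (B' * \<epsilon>\<^sub>0)"
    define I where "I = N powr (4/3 - \<epsilon>)"
    have T: "T > 0"
      using C' N by (simp add: T_def)
    have fin: "finite \<L>" "finite \<P>" and line: "\<And>l. l \<in> \<L> \<Longrightarrow> is_line l"
      using conf by (auto simp: configuration_def)
    have r: "r > 0" and n: "real n = r\<^sup>2" and disj: "disjoint_family_on C {1..n}"
      and cover: "(\<Union>i\<in>{1..n}. C i) = \<P>"
      and met: "\<And>l. l \<in> \<L> \<Longrightarrow> real (card {i\<in>{1..n}. \<exists>p\<in>C i. p \<in> l}) \<le> K * r"
      using dec by (auto simp: point_weighted_cell_decomposition_def)
    obtain e where e: "0 \<le> e" "e \<le> B * \<epsilon>\<^sub>0"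
      and size: "\<And>i. i \<in> {1..n} \<Longrightarrow> real (card (C i)) \<le> A * (N powr (1 + e) / r\<^sup>2)"
      using dec by (auto simp: point_weighted_cell_decomposition_def)
    have finC: "finite (C i)" if "i \<in> {1..n}" for i
      using fin(2) cover that by (metis UN_upper finite_subset)
    define J where "J = incidences_with_count (\<lambda>k. 2 \<le> k \<and> real k \<le> T) \<L> n C"
    define S where "S = incidences_with_count (\<lambda>k. k = 1) \<L> n C"
    define R where "R = incidences_with_count (\<lambda>k. 2 \<le> k \<and> T < real k) \<L> n C"
    have "incidences \<L> \<P> \<subseteq> J \<union> S \<union> R"
    proof (intro subsetI)
      fix x assume "x \<in> incidences \<L> \<P>"
      then obtain l p i where x: "x = (l, p)" "l \<in> \<L>" "i \<in> {1..n}" "p \<in> C i" "p \<in> l"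
        using cover by (auto simp: incidences_def)
      then have "card (C i \<inter> l) \<noteq> 0"
        using finC by auto
      then have "card (C i \<inter> l) = 1 \<or> 2 \<le> card (C i \<inter> l)"
        by linarith
      with x show "x \<in> J \<union> S \<union> R"
        unfolding J_def S_def R_def incidences_with_count_def by force
    qed
    moreover have "finite (J \<union> S \<union> R)"
      unfolding J_def S_def R_def by (intro finite_UnI finite_incidences_with_count fin finC)
    ultimately have "card (incidences \<L> \<P>) \<le> card (J \<union> S \<union> R)"
      by (simp add: card_mono)
    also have "\<dots> \<le> card J + card S + card R"
      by (meson card_Un_le order_trans add_right_mono)
    finally have sum: "I \<le> real (card J) + real (card S) + real (card R)"
      using card_I by (simp add: I_def)
    have "real (card S) \<le> K * r * real (card \<L>)"
      unfolding S_def by (intro card_singly_met_incidences_le fin finC met)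
    also have "\<dots> \<le> max K 0 * (r * real (card \<L>))"
      using r by (simp add: mult.assoc mult_right_mono)
    \<comment> \<open>The upper bound on \<open>r\<close> with its denominator cleared. If
      \<open>\<L>\<close> is empty, the quotient is 0 by convention, but the left side here is 0 as
      well.\<close>
    also have "r * real (card \<L>) \<le> I / 100"
      using r_le r card_I by (cases "card \<L> = 0") (auto simp: I_def field_simps)
    finally have S: "real (card S) \<le> max K 0 * (I / 100)"
      by (simp add: mult_left_mono)
    have "real (card R) \<le> real n * (2 * (A * (N powr (1 + e) / r\<^sup>2))\<^sup>2 / T)"
      unfolding R_def by (intro card_richly_met_incidences_le fin line finC T size)
    \<comment> \<open>Summing over \<open>r\<^sup>2\<close> cells cancels only half of the fourth
      power of \<open>r\<close> in the denominator; the remaining \<open>r\<^sup>2\<close> is what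
      the lower bound on \<open>r\<close> controls.\<close>
    also have "\<dots> = 2 * A\<^sup>2 * (N powr (1 + e))\<^sup>2 / (r\<^sup>2 * T)"
      using r T by (simp add: n field_simps power2_eq_square)
    also have "\<dots> \<le> \<delta> * I"
    proof -
      \<comment> \<open>The middle bracket is the exponent in the lower bound for
        \<open>r\<^sup>2\<close>. What remains to be checked is
        \<open>2 * e + 11 * \<epsilon> \<le> B' * \<epsilon>\<^sub>0\<close>.\<close>
      have exps: "2 + 2 * e \<le> (4/3 - \<epsilon>) + (2/3 - 10 * \<epsilon>) + B' * \<epsilon>\<^sub>0"
      proof -
        have "13 * B * \<epsilon>\<^sub>0 \<le> B' * \<epsilon>\<^sub>0"
          using \<epsilon>\<^sub>0 by (intro mult_right_mono) (auto simp: B'_def)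
        then show ?thesis
          using e \<epsilon> by linarith
      qed
      have "(N powr (1 + e))\<^sup>2 = N powr (2 + 2 * e)"
        by (simp add: power2_eq_square flip: powr_add)
      also have "\<dots> \<le> N powr ((4/3 - \<epsilon>) + (2/3 - 10 * \<epsilon>) + B' * \<epsilon>\<^sub>0)"
        using exps N by (intro powr_mono) auto
      also have "\<dots> = I * (N powr (1/3 - 5 * \<epsilon>))\<^sup>2 * N powr (B' * \<epsilon>\<^sub>0)"
        by (simp add: I_def power2_eq_square flip: powr_add)
      also have "\<dots> \<le> I * r\<^sup>2 * N powr (B' * \<epsilon>\<^sub>0)"
        using r_ge by (intro mult_right_mono mult_left_mono power_mono) (auto simp: I_def)
      finally have "2 * A\<^sup>2 * (N powr (1 + e))\<^sup>2 \<le> 2 * (A\<^sup>2 + 1) * (I * r\<^sup>2 * N powr (B' * \<epsilon>\<^sub>0))"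
        by (intro mult_mono) auto
      also have "\<dots> = \<delta> * I * (r\<^sup>2 * T)"
        using \<delta> by (simp add: T_def C'_def)
      finally show ?thesis
        using r T by (simp add: pos_divide_le_eq)
    qed
    finally have R: "real (card R) \<le> \<delta> * I" .
    \<comment> \<open>By the choice of \<open>\<delta>\<close>, removing \<open>S\<close> leaves at
      least \<open>2 * \<delta> * I\<close> incidences, of which \<open>R\<close> takes at most
      half.\<close>
    have "max K 0 * (I / 100) = I - 2 * (\<delta> * I)"
      by (simp add: \<delta>_def field_simps)
    then have "\<delta> * I \<le> real (card J)"
      using sum S R by linarith
    moreover have "J \<subseteq> incidences \<L> \<P>"
      using cover by (fastforce simp: J_def incidences_with_count_def incidences_def)
    moreover have "2 \<le> card (incidences {l} (C i)) \<and> real (card (incidences {l} (C i))) \<le> T"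
      if i: "i \<in> {1..n}" and p: "p \<in> C i" and lp: "(l, p) \<in> J" for l i p
    proof -
      \<comment> \<open>Membership in \<open>J\<close> only provides some cell containing
        \<open>p\<close> with the right count; disjointness of the cells identifies it with
        \<open>C i\<close>.\<close>
      obtain j where j: "j \<in> {1..n}" "p \<in> C j" "2 \<le> card (C j \<inter> l)" "real (card (C j \<inter> l)) \<le> T"
        using lp by (auto simp: J_def incidences_with_count_def)
      then have "i = j"
        using disjoint_family_onD[OF disj i] p by blast
      with j show ?thesis
        by (simp add: card_incidences_singleton)
    qed
    \<comment> \<open>The witness for \<open>e\<close> is the top of its range, the exponent built
      into \<open>T\<close>.\<close>
    moreover have "B' * \<epsilon>\<^sub>0 \<in> {0..B' * \<epsilon>\<^sub>0}"
      using B' \<epsilon>\<^sub>0 by simp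
    ultimately show ?thesis
      unfolding T_def I_def by blast
  qed
  show ?thesis
  proof (rule exI[of _ \<delta>], rule exI[of _ C'], rule exI[of _ B'], intro conjI allI impI \<delta> C' B')
    fix \<epsilon>\<^sub>0 \<epsilon> :: real
    assume \<epsilon>: "\<epsilon>\<^sub>0 > 0" "\<epsilon> \<le> B * \<epsilon>\<^sub>0"
    show "\<forall>\<^sub>F N :: real in at_top. \<forall>\<L> \<P> r n C.
        configuration A B \<epsilon>\<^sub>0 N \<L> \<P> \<longrightarrow>
        extremal A B \<epsilon>\<^sub>0 N \<L> \<P> \<longrightarrow>
        real (card (incidences \<L> \<P>)) = N powr (4/3 - \<epsilon>) \<longrightarrow>
        point_weighted_cell_decomposition K A B \<epsilon>\<^sub>0 N \<L> \<P> r n C \<longrightarrow>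
        N powr (1/3 - 5 * \<epsilon>) \<le> r \<longrightarrow>
        r \<le> real (card (incidences \<L> \<P>)) / (100 * real (card \<L>)) \<longrightarrow>
        (\<exists>J \<subseteq> incidences \<L> \<P>.
           \<delta> * N powr (4/3 - \<epsilon>) \<le> real (card J) \<and>
           (\<exists>e\<in>{0..B' * \<epsilon>\<^sub>0}. \<forall>l\<in>\<L>. \<forall>i\<in>{1..n}. (\<exists>p\<in>C i. (l, p) \<in> J) \<longrightarrow>
              2 \<le> card (incidences {l} (C i)) \<and>
              real (card (incidences {l} (C i))) \<le> C' * N powr e))"
      by (intro eventually_mono[OF eventually_ge_at_top[of 1]] allI impI) (rule main[OF \<epsilon>])
  qed
qed

end
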